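(* Let $X,Y$ be indeterminates, $\sigma_1=X+Y-1$, $\sigma_2=XY-X-Y$, $\sigma_3=-XY$, $$I=\sigma_1^2-12\sigma_2,\qquad J=\sigma_1^2\sigma_2-6\sigma_2^2+9\sigma_1\sigma_3,\qquad \delta=(1+X)(1+Y)(X-Y),\qquad \mathcal D=\delta^2.$$ Let $t_1,t_2,t_3,t_4$ be the roots, in an algebraic closure of $\mathbb Q(X,Y)$, of the quartic $$Q_4(t)=t^4-\frac I2t^2+4\delta t+\left(\frac{I^2}{16}+2J\right).$$ Then the three quantities $(t_1+t_2)^2,\ (t_1+t_3)^2,\ (t_1+t_4)^2$ are the three roots of the cubic $C(U)=U^3-IU^2-8JU-16\mathcal D$, and consequently the six roots of the sextic $Z^6-IZ^4-8JZ^2-16\mathcal D$ are the pair sums $t_i+t_j$, $1\le i<j\le4$.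
   Context: Roots are counted with multiplicity. *)

theory Defs
  imports
    "HOL-Computational_Algebra.Computational_Algebra"
    "HOL-Algebra.Algebraic_Closure_Type"
begin

text \<open>
  The field \<open>\<rat>(X,Y)\<close> is the fraction field of \<open>\<rat>[X][Y]\<close>; the inner
  indeterminate is \<open>X\<close>, the outer one is \<open>Y\<close>.
\<close>

type_synonym rat_XY = "rat poly poly fract"

definition varX :: rat_XY where
  "varX = Fract [:[:0, 1:]:] 1"

definition varY :: rat_XY where
  "varY = Fract [:0, 1:] 1"

definition sigma1 :: rat_XY where
  "sigma1 = varX + varY - 1"

definition sigma2 :: rat_XY where
  "sigma2 = varX * varY - varX - varY"

definition sigma3 :: rat_XY where
  "sigma3 = - (varX * varY)"

definition invI :: rat_XY where
  "invI = sigma1^2 - 12 * sigma2"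

definition invJ :: rat_XY where
  "invJ = sigma1^2 * sigma2 - 6 * sigma2^2 + 9 * sigma1 * sigma3"

definition delta :: rat_XY where
  "delta = (1 + varX) * (1 + varY) * (varX - varY)"

definition discD :: rat_XY where
  "discD = delta^2"

text \<open>Coefficients are listed from the constant term upwards.\<close>

definition quartic_Q4 :: "rat_XY poly" where
  "quartic_Q4 = [: invI^2 / 16 + 2 * invJ, 4 * delta, - (invI / 2), 0, 1 :]"

definition cubic_C :: "rat_XY poly" where
  "cubic_C = [: - 16 * discD, - 8 * invJ, - invI, 1 :]"

definition sextic_Z :: "rat_XY poly" where
  "sextic_Z = [: - 16 * discD, 0, - 8 * invJ, 0, - invI, 0, 1 :]"

text \<open>
  An algebraic closure of a field \<open>'k\<close> is an algebraically closed field \<open>'a\<close>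
  (expressed by the type class) together with an embedding of \<open>'k\<close> over which every
  element of \<open>'a\<close> is algebraic. A unital ring homomorphism between fields is
  automatically injective and maps \<open>0\<close> to \<open>0\<close>.
\<close>

definition alg_closure_embedding :: "('k::field \<Rightarrow> 'a::alg_closed_field) \<Rightarrow> bool" where
  "alg_closure_embedding \<iota> \<longleftrightarrow>
     \<iota> 1 = 1 \<and>
     (\<forall>x y. \<iota> (x + y) = \<iota> x + \<iota> y) \<and>
     (\<forall>x y. \<iota> (x * y) = \<iota> x * \<iota> y) \<and>
     (\<forall>z. \<exists>p :: 'k poly. p \<noteq> 0 \<and> poly (map_poly \<iota> p) z = 0)"

lemma alg_closure_embedding_to_ac:
  "alg_closure_embedding (to_ac :: 'k::field \<Rightarrow> 'k alg_closure)"
  unfolding alg_closure_embedding_def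
  by (auto intro: alg_closure_algebraic)

end

theory Submission
  imports Defs
begin

text \<open>
  For \<open>t\<^sup>4 + p t\<^sup>2 + q t + r\<close> the root sum vanishes, so \<open>t\<^sub>3 + t\<^sub>4 = -(t\<^sub>1 + t\<^sub>2)\<close>
  and the numbers \<open>(t\<^sub>1 + t\<^sub>i)\<^sup>2\<close> are the roots of the resolvent cubic
  \<open>U\<^sup>3 + 2 p U\<^sup>2 + (p\<^sup>2 - 4 r) U - q\<^sup>2\<close>. For \<open>Q\<^sub>4\<close> this resolvent is \<open>C\<close>; substituting
  \<open>U = Z\<^sup>2\<close> splits each \<open>U - (t\<^sub>1 + t\<^sub>i)\<^sup>2\<close> into the factors of two opposite pair sums.
\<close>

text \<open>Over an algebraically closed field a monic polynomial is the product of the linear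
  factors of its root multiset, so Vieta's formulas follow by comparing coefficients.\<close>

lemma depressed_quartic_vieta:
  fixes a b c d p q r :: "'a :: alg_closed_field"
  assumes "proots [:r, q, p, 0, 1:] = {#a, b, c, d#}"
  shows "a + b + c + d = 0"
    and "p = a*b + a*c + a*d + b*c + b*d + c*d"
    and "q = - (a*b*c + a*b*d + a*c*d + b*c*d)"
    and "r = a*b*c*d"
proof -
  have "[:r, q, p, 0, 1:] = [:- a, 1:] * [:- b, 1:] * [:- c, 1:] * [:- d, 1:]"
    (is "?Q = _")
  proof -
    obtain A where A: "size A = degree ?Q" "?Q = smult (lead_coeff ?Q) (\<Prod>x\<in>#A. [:- x, 1:])"
      using alg_closed_imp_factorization[of ?Q] by auto
    hence Q: "?Q = (\<Prod>x\<in>#A. [:- x, 1:])"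
      by simp
    \<comment> \<open>The factorization supplies some multiset \<open>A\<close>; reading off the
      roots of the product identifies it with the given one, multiplicities included.\<close>
    have "proots (\<Prod>x\<in>#A. [:- x, 1:]) = A"
    proof (induction A)
      case (add x A)
      have "(\<Prod>x\<in>#A. [:- x, 1:]) \<noteq> 0"
        by (auto simp: prod_mset_zero_iff)
      thus ?case
        using add by (simp add: proots_mult del: mult_pCons_left)
    qed simp
    hence "A = {#a, b, c, d#}"
      using assms Q by simp
    thus ?thesis
      unfolding Q by (simp add: mult.assoc del: mult_pCons_left mult_pCons_right)
  qed
  thus "a + b + c + d = 0"
    and "p = a*b + a*c + a*d + b*c + b*d + c*d"
    and "q = - (a*b*c + a*b*d + a*c*d + b*c*d)"
    and "r = a*b*c*d"
    by (auto simp: algebra_simps) 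
qed

lemma proots_resolvent_cubic:
  fixes a b c d p q r :: "'a :: alg_closed_field"
  assumes "proots [:r, q, p, 0, 1:] = {#a, b, c, d#}"
  shows "proots [:- q\<^sup>2, p\<^sup>2 - 4 * r, 2 * p, 1:] = {#(a + b)\<^sup>2, (a + c)\<^sup>2, (a + d)\<^sup>2#}"
    and "proots [:- q\<^sup>2, 0, p\<^sup>2 - 4 * r, 0, 2 * p, 0, 1:] =
           {#a + b, a + c, a + d, b + c, b + d, c + d#}"
proof -
  note vieta = depressed_quartic_vieta[OF assms]
  \<comment> \<open>Once \<open>p\<close>, \<open>q\<close>, \<open>r\<close> are expressed in the
    roots and \<open>d\<close> is eliminated, both factorizations below become polynomial identities
    in \<open>a\<close>, \<open>b\<close>, \<open>c\<close>.\<close>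
  have d: "d = - (a + b + c)"
    using vieta(1) by (metis add.commute eq_neg_iff_add_eq_0)
  have "[:- q\<^sup>2, p\<^sup>2 - 4 * r, 2 * p, 1:] = [:- (a + b)\<^sup>2, 1:] * [:- (a + c)\<^sup>2, 1:] * [:- (a + d)\<^sup>2, 1:]"
    unfolding vieta(2-4) d by (simp add: power2_eq_square algebra_simps)
  thus "proots [:- q\<^sup>2, p\<^sup>2 - 4 * r, 2 * p, 1:] = {#(a + b)\<^sup>2, (a + c)\<^sup>2, (a + d)\<^sup>2#}"
    by (simp add: proots_mult del: mult_pCons_left mult_pCons_right)
  have "[:- q\<^sup>2, 0, p\<^sup>2 - 4 * r, 0, 2 * p, 0, 1:] =
      [:- (a + b), 1:] * [:- (a + c), 1:] * [:- (a + d), 1:] *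
      [:- (b + c), 1:] * [:- (b + d), 1:] * [:- (c + d), 1:]"
    unfolding vieta(2-4) d by (simp add: power2_eq_square algebra_simps)
  thus "proots [:- q\<^sup>2, 0, p\<^sup>2 - 4 * r, 0, 2 * p, 0, 1:] =
           {#a + b, a + c, a + d, b + c, b + d, c + d#}"
    by (simp add: proots_mult del: mult_pCons_left mult_pCons_right minus_add_distrib)
qed

theorem mainTheorem4:
  fixes \<iota> :: "rat_XY \<Rightarrow> 'a :: alg_closed_field"
    and t1 t2 t3 t4 :: 'a
  assumes "alg_closure_embedding \<iota>"
    and "proots (map_poly \<iota> quartic_Q4) = {#t1, t2, t3, t4#}"
  shows "proots (map_poly \<iota> cubic_C) = {#(t1 + t2)^2, (t1 + t3)^2, (t1 + t4)^2#} \<and>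
         proots (map_poly \<iota> sextic_Z) =
           {#t1 + t2, t1 + t3, t1 + t4, t2 + t3, t2 + t4, t3 + t4#}"
proof -
  have one: "\<iota> 1 = 1" and add: "\<And>x y. \<iota> (x + y) = \<iota> x + \<iota> y"
    and mult: "\<And>x y. \<iota> (x * y) = \<iota> x * \<iota> y"
    using assms(1) by (auto simp: alg_closure_embedding_def)
  have zero: "\<iota> 0 = 0"
    using add[of 1 0] by (simp add: one)
  have minus: "\<iota> (- x) = - \<iota> x" for x
    using add[of x "- x"] by (simp add: zero eq_neg_iff_add_eq_0 add.commute)
  have diff: "\<iota> (x - y) = \<iota> x - \<iota> y" for x y
    using add[of x "- y"] by (simp add: minus)
  have two: "\<iota> 2 = 2"
    using add[of 1 1] by (simp add: one)
  have four: "\<iota> 4 = 4"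
    using add[of 2 2] by (simp add: two)
  \<comment> \<open>Keeping the coefficients of \<open>quartic_Q4\<close> opaque means that
    \<open>\<iota>\<close> need not be pushed through the divisions by 2 and 16; only the numerals 2
    and 4 have to be transported.\<close>
  define p q r where "p = - (invI / 2)" and "q = 4 * delta" and "r = invI^2 / 16 + 2 * invJ"
  \<comment> \<open>This matches \<open>cubic_C\<close> with the resolvent inside the base field:
    the terms \<open>invI^2 / 4\<close> cancel in \<open>p\<^sup>2 - 4 * r\<close>.\<close>
  have "- invI = 2 * p" "- 8 * invJ = p\<^sup>2 - 4 * r" "- 16 * discD = - q\<^sup>2"
    by (simp_all add: p_def q_def r_def discD_def power2_eq_square)
  hence "map_poly \<iota> cubic_C = [:- (\<iota> q)\<^sup>2, (\<iota> p)\<^sup>2 - 4 * \<iota> r, 2 * \<iota> p, 1:]"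
    and "map_poly \<iota> sextic_Z = [:- (\<iota> q)\<^sup>2, 0, (\<iota> p)\<^sup>2 - 4 * \<iota> r, 0, 2 * \<iota> p, 0, 1:]"
    by (simp_all add: cubic_C_def sextic_Z_def map_poly_pCons one zero mult minus diff two four
        power2_eq_square)
  moreover have "map_poly \<iota> quartic_Q4 = [:\<iota> r, \<iota> q, \<iota> p, 0, 1:]"
    by (simp add: quartic_Q4_def p_def q_def r_def map_poly_pCons one zero)
  ultimately show ?thesis
    using assms(2) proots_resolvent_cubic[of "\<iota> r" "\<iota> q" "\<iota> p" t1 t2 t3 t4] by simp
qed

end
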